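(* Let $k\in\mathbb{N}$ and $n_1,\dots,n_k\in\{2,3,4,\dots\}$ with $n_1-1\mid n_j-1$ for all $j\in\{1,\dots,k\}$. The linear order of the upper bound $|w|_X\le d\,L(w)$ (valid for all $w\in F(n_1,\dots,n_k)$ with a fixed $d\in\mathbb{N}$) is sharp: there exist a constant $\varepsilon>0$ and a sequence $(w_m)_{m\ge1}$ of elements of $F(n_1,\dots,n_k)$ with $L(w_m)\to\infty$ and $|w_m|_X\ge\varepsilon L(w_m)$ for all $m$.
   Context: $F(n_1,\dots,n_k)$ is the group (product $xy=x\circ y$) of piecewise-linear orientation-preserving homeomorphisms of $[0,1]$ with finitely many breakpoints, all in $\mathbb{Z}[\frac{1}{n_1\cdots n_k}]$, and slopes in the multiplicative group $\langle n_1,\dots,n_k\rangle$. An $n$-ary caret (caret of type $n$) has one parent vertex joined by $n$ edges to $n$ child vertices, ordered from left to right. An $(n_1,\dots,n_k)$-ary tree is a rooted tree formed from finitely many (possibly zero) carets of types in $\{n_1,\dots,n_k\}$ by identifying child vertices of carets with parent vertices of other carets. Leaves are numbered $0,1,2,\dots$ from left to right. The root represents $[0,1]$, and the children of an $n$-ary caret represent, from left to right, the $n$ equal consecutive closed subintervals of the parent's interval. A tree-pair diagram $(T_-,T_+)$ is an ordered pair of such trees with equally many leaves (domain tree $T_-$, range tree $T_+$); it represents the element mapping the $i$th leaf interval of $T_-$ affinely and increasingly onto the $i$th leaf interval of $T_+$, for all $i$. Every element is represented by some diagram. A diagram is minimal if it has the fewest leaves among all diagrams representing the same element; $L(x)$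 is the number of leaves in either tree of a minimal diagram for $x$. Generators. A right $n_1$-string is a tree all of whose carets are of type $n_1$ and have an edge on the rightmost root-to-leaf path. For $j\in\{2,\dots,k\}$, $i\ge0$, $(y_j)_i$ has range tree a right $n_1$-string of $i$ carets with an $n_j$-ary caret attached to its last leaf, and domain tree the right $n_1$-string with the same number of leaves. For $j\in\{1,\dots,k\}$, $i\ge 0$, $(z_j)_i$ has range tree a right $n_1$-string of $\lfloor i/(n_1-1)\rfloor+1$ carets with an $n_j$-ary caret attached to the leaf numbered $i$, and domain tree the right $n_1$-string with the same number of leaves. The standard finite generating set is $X=\{(y_i)_0,\dots,(y_i)_{n_i-1}: 2\le i\le k\}\cup\{(z_j)_0,\dots,(z_j)_{n_j-1}:1\le j\le k\}$, and $|x|_X$ is the word length of $x$ with respect to $X$. *)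

theory Defs
  imports "HOL-Analysis.Analysis" "HOL-Algebra.Bij"
begin

text \<open>
  The parameters $n_1, \dots, n_k$ are \<open>n 1, \<dots>, n k\<close> for a function \<open>n :: nat \<Rightarrow> nat\<close>; values
  of \<open>n\<close> outside \<open>{1..k}\<close> are irrelevant.
\<close>

section \<open>The group\<close>

definition localized_ints :: "nat \<Rightarrow> real set" where
  "localized_ints N = {of_int a / of_nat N ^ e | (a :: int) (e :: nat). True}"

definition slope_group :: "nat \<Rightarrow> (nat \<Rightarrow> nat) \<Rightarrow> real set" where
  "slope_group k n = {\<Prod>j=1..k. real (n j) powi e j | e :: nat \<Rightarrow> int. True}"

text \<open>
  \<open>B\<close> is a finite set containing all breakpoints: the map is affine on every interval with no
  point of \<open>B\<close> in its interior.
\<close>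

definition pl_with ::
    "real set \<Rightarrow> real set \<Rightarrow> (real \<Rightarrow> real) \<Rightarrow> bool" where
  "pl_with P S f \<longleftrightarrow>
    (\<exists>B. finite B \<and> B \<subseteq> P \<inter> {0..1} \<and>
      (\<forall>a b. 0 \<le> a \<and> a < b \<and> b \<le> 1 \<and> {a<..<b} \<inter> B = {} \<longrightarrow>
        (\<exists>s\<in>S. \<exists>c. \<forall>x\<in>{a..b}. f x = s * x + c)))"

definition F_elements :: "nat \<Rightarrow> (nat \<Rightarrow> nat) \<Rightarrow> (real \<Rightarrow> real) set" where
  "F_elements k n =
    {f \<in> extensional {0..1}.
      (\<exists>g. homeomorphism {0..1} {0..1} f g) \<and>
      strict_mono_on {0..1} f \<and>
      pl_with (localized_ints (\<Prod>j=1..k. n j)) (slope_group k n) f}"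

text \<open>
  The product of \<^const>\<open>BijGroup\<close> is composition, \<open>x \<otimes> y = x \<circ> y\<close> on \<open>{0..1}\<close>.
\<close>

definition F_group :: "nat \<Rightarrow> (nat \<Rightarrow> nat) \<Rightarrow> (real \<Rightarrow> real) monoid" where
  "F_group k n = (BijGroup {0..1}) \<lparr>carrier := F_elements k n\<rparr>"

section \<open>Trees and tree-pair diagrams\<close>

datatype ctree = Leaf | Caret "ctree list"

fun is_tree :: "nat set \<Rightarrow> ctree \<Rightarrow> bool" where
  "is_tree A Leaf \<longleftrightarrow> True"
| "is_tree A (Caret ts) \<longleftrightarrow> length ts \<in> A \<and> (\<forall>t\<in>set ts. is_tree A t)"

primrec leaves :: "ctree \<Rightarrow> nat" where
  "leaves Leaf = 1"
| "leaves (Caret ts) = sum_list (map leaves ts)"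

text \<open>
  The list of pairs of end points of the leaf intervals, from left to right, when the root
  represents \<open>{a..b}\<close>.
\<close>

primrec leaf_intervals :: "ctree \<Rightarrow> real \<Rightarrow> real \<Rightarrow> (real \<times> real) list" where
  "leaf_intervals Leaf = (\<lambda>a b. [(a, b)])"
| "leaf_intervals (Caret ts) = (\<lambda>a b.
     concat (map2 (\<lambda>i f. f (a + real i * (b - a) / real (length ts))
                          (a + real (Suc i) * (b - a) / real (length ts)))
       [0..<length ts] (map leaf_intervals ts)))"

definition leaf_interval :: "ctree \<Rightarrow> nat \<Rightarrow> real \<times> real" where
  "leaf_interval t i = leaf_intervals t 0 1 ! i"

definition is_diagram :: "nat set \<Rightarrow> ctree \<times> ctree \<Rightarrow> bool" where
  "is_diagram A D \<longleftrightarrow>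
    is_tree A (fst D) \<and> is_tree A (snd D) \<and> leaves (fst D) = leaves (snd D)"

definition represents :: "ctree \<times> ctree \<Rightarrow> (real \<Rightarrow> real) \<Rightarrow> bool" where
  "represents D f \<longleftrightarrow> f \<in> extensional {0..1} \<and>
    (\<forall>i < leaves (fst D).
      let (a, b) = leaf_interval (fst D) i; (c, d) = leaf_interval (snd D) i
      in \<forall>x\<in>{a..b}. f x = c + (d - c) / (b - a) * (x - a))"

definition diagram_map :: "ctree \<times> ctree \<Rightarrow> real \<Rightarrow> real" where
  "diagram_map D = (THE f. represents D f)"

text \<open>
  \<open>Inf {}\<close> is unspecified on \<open>nat\<close>; here the empty set gets the value \<open>0\<close>.
\<close>

definition minimum :: "nat set \<Rightarrow> nat" where
  "minimum S = (if S = {} then 0 else LEAST m. m \<in> S)"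

definition leaf_number :: "nat \<Rightarrow> (nat \<Rightarrow> nat) \<Rightarrow> (real \<Rightarrow> real) \<Rightarrow> nat" where
  "leaf_number k n x =
    minimum {leaves (fst D) | D. is_diagram (n ` {1..k}) D \<and> represents D x}"

section \<open>The standard finite generating set\<close>

fun right_string :: "nat \<Rightarrow> nat \<Rightarrow> ctree" where
  "right_string m 0 = Leaf"
| "right_string m (Suc c) = Caret (replicate (m - 1) Leaf @ [right_string m c])"

text \<open>\<open>attach m i t\<close> attaches an \<open>m\<close>-ary caret to the leaf of \<open>t\<close> numbered \<open>i\<close>.\<close>

fun attach :: "nat \<Rightarrow> nat \<Rightarrow> ctree \<Rightarrow> ctree"
  and attach_list :: "nat \<Rightarrow> nat \<Rightarrow> ctree list \<Rightarrow> ctree list" where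
  "attach m i Leaf = Caret (replicate m Leaf)"
| "attach m i (Caret ts) = Caret (attach_list m i ts)"
| "attach_list m i [] = []"
| "attach_list m i (t # ts) =
    (if i < leaves t then attach m i t # ts else t # attach_list m (i - leaves t) ts)"

text \<open>
  A right \<open>m\<close>-string of \<open>c\<close> carets has \<open>c * (m - 1) + 1\<close> leaves. The division below is exact
  for the range trees used here, because \<open>n 1 - 1\<close> divides every \<open>n j - 1\<close>.
\<close>

definition over_right_string :: "nat \<Rightarrow> ctree \<Rightarrow> ctree \<times> ctree" where
  "over_right_string m T = (right_string m ((leaves T - 1) div (m - 1)), T)"

definition y_gen :: "(nat \<Rightarrow> nat) \<Rightarrow> nat \<Rightarrow> nat \<Rightarrow> real \<Rightarrow> real" where
  "y_gen n j i =
    (let R = right_string (n 1) i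
     in diagram_map (over_right_string (n 1) (attach (n j) (leaves R - 1) R)))"

definition z_gen :: "(nat \<Rightarrow> nat) \<Rightarrow> nat \<Rightarrow> nat \<Rightarrow> real \<Rightarrow> real" where
  "z_gen n j i =
    (let R = right_string (n 1) (i div (n 1 - 1) + 1)
     in diagram_map (over_right_string (n 1) (attach (n j) i R)))"

definition std_gens :: "nat \<Rightarrow> (nat \<Rightarrow> nat) \<Rightarrow> (real \<Rightarrow> real) set" where
  "std_gens k n =
    {y_gen n j i | j i. j \<in> {2..k} \<and> i < n j} \<union> {z_gen n j i | j i. j \<in> {1..k} \<and> i < n j}"

section \<open>Word length\<close>

text \<open>
  An element outside the subgroup generated by \<open>X\<close> gets length \<open>0\<close>, so that a lower bound
  on the word length of an element never holds merely because no word represents it.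
\<close>

definition word_length :: "('a, 'b) monoid_scheme \<Rightarrow> 'a set \<Rightarrow> 'a \<Rightarrow> nat" where
  "word_length G X g =
    minimum {length u | u. set u \<subseteq> X \<union> m_inv G ` X \<and> foldr (mult G) u (one G) = g}"

end

(*
  The slope at 0 is a homomorphism from F(n_1, ..., n_k) to the positive reals, and it is bounded on
  the finitely many generators and their inverses; hence an element with slope (1/n_1)^m at 0 has
  word length at least a constant times m. This applies to the powers w_m = x^m of the generator
  x = (z_1)_0, whose slope at 0 is 1/n_1. The number of leaves of x^m is at most linear in m, because
  x^m is represented by the pair of the right and the left n_1-string with m + 1 carets. It tends to
  infinity, because a diagram with L leaves has slope at least N^(-L) at 0, where N = n_1 ... n_k.
*)

theory Submission
  imports Defs
begin

section \<open>Affine correspondence of subdivisions\<close>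

text \<open>Word length and leaf number are minima over all words and all diagrams, so each lower
  bound must hold for an arbitrary competitor. The slope at 0 allows this: a word is controlled
  factor by factor, and a diagram through its two leftmost leaf intervals alone. An upper bound
  needs only one witness, but that witness is a whole diagram for \<open>w_m\<close>, which takes a
  composition of diagrams. It is obtained by refining both trees of a diagram by the same carets.
  The generators are given by trees and the group by maps, so the link between them has to be built:
  two trees with equally many leaves determine a unique homeomorphism, it lies in the group, and
  swapping the trees inverts it. The resulting constant is \<epsilon> = 1/(3 n_1 r), where (1/n_1)^r
  is a lower bound for the slopes at 0 of all generators and their inverses: for m \<ge> 1 there are
  at most 3 n_1 m leaves, while any word for \<open>w_m\<close> has at least m/r letters.\<close>

fun chain :: "real \<Rightarrow> real \<Rightarrow> (real \<times> real) list \<Rightarrow> bool" where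
  "chain a b [] \<longleftrightarrow> a = b"
| "chain a b (I # Is) \<longleftrightarrow> fst I = a \<and> a < snd I \<and> chain (snd I) b Is"

text \<open>The formula in the definition of \<open>represents\<close>, as a relation between two
  intervals: with \<open>list_all2\<close> it says that a map carries one subdivision piecewise
  affinely to another.\<close>

fun affine_on :: "(real \<Rightarrow> real) \<Rightarrow> real \<times> real \<Rightarrow> real \<times> real \<Rightarrow> bool" where
  "affine_on f (a, b) (c, d) \<longleftrightarrow> (\<forall>x\<in>{a..b}. f x = c + (d - c) / (b - a) * (x - a))"

lemma chain_append: "chain a b (Is @ Js) \<longleftrightarrow> (\<exists>m. chain a m Is \<and> chain m b Js)"
  by (induction Is arbitrary: a) auto

lemma chain_concat:
  assumes "\<And>i. i < m \<Longrightarrow> chain (g i) (g (Suc i)) (F i)"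
  shows "chain (g 0) (g m) (concat (map F [0..<m]))"
  using assms by (induction m) (auto simp: chain_append)

lemma chain_le: "chain a b Is \<Longrightarrow> a \<le> b"
proof (induction Is arbitrary: a)
  case (Cons I Is)
  then have "snd I \<le> b" by simp
  then show ?case using Cons.prems by simp
qed simp

lemma chain_bounds:
  assumes "chain a b Is" "I \<in> set Is"
  shows "a \<le> fst I" "fst I < snd I" "snd I \<le> b"
proof -
  obtain Js Ks where "Is = Js @ I # Ks" using assms(2) by (auto simp: in_set_conv_decomp)
  then show "a \<le> fst I" "fst I < snd I" "snd I \<le> b"
    using assms(1) by (auto simp: chain_append dest: chain_le)
qed

lemma chain_cover:
  assumes "chain a b Is" "Is \<noteq> []" "x \<in> {a..b}"
  shows "\<exists>I\<in>set Is. x \<in> {fst I..snd I}"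
  using assms
proof (induction Is arbitrary: a)
  case (Cons I Is)
  show ?case
  proof (cases "x \<le> snd I")
    case True
    then show ?thesis using Cons.prems by auto
  next
    case False
    then have "Is \<noteq> []" using Cons.prems by auto
    then show ?thesis using Cons.IH[of "snd I"] Cons.prems False by auto
  qed
qed auto

lemma affine_on_endpoints:
  assumes "affine_on f I J" "fst I < snd I"
  shows "f (fst I) = fst J" "f (snd I) = snd J"
proof -
  obtain a b c d where [simp]: "I = (a, b)" "J = (c, d)" by (cases I; cases J)
  show "f (fst I) = fst J" "f (snd I) = snd J" using assms by auto
qed

lemma affine_on_mono:
  assumes "affine_on f I J" "fst J < snd J" "fst I \<le> x" "x < y" "y \<le> snd I"
  shows "f x < f y"
proof -
  obtain a b c d where [simp]: "I = (a, b)" "J = (c, d)" by (cases I; cases J)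
  have "(d - c) / (b - a) * (x - a) < (d - c) / (b - a) * (y - a)"
    using assms by (intro mult_strict_left_mono) auto
  then show ?thesis using assms by simp
qed

lemma affine_on_maps_to:
  assumes "affine_on f I J" "fst J < snd J" "x \<in> {fst I..snd I}"
  shows "f x \<in> {fst J..snd J}"
proof -
  obtain a b c d where [simp]: "I = (a, b)" "J = (c, d)" by (cases I; cases J)
  have f: "f x = c + (d - c) / (b - a) * (x - a)" using assms by simp
  show ?thesis
  proof (cases "a = b")
    case False
    then have "(x - a) / (b - a) \<in> {0..1}" using assms(3) by (auto simp: divide_simps)
    then have "(d - c) * ((x - a) / (b - a)) \<in> {0..d - c}"
      using assms(2) mult_left_mono[of "(x - a) / (b - a)" 1 "d - c"]
        mult_nonneg_nonneg[of "d - c" "(x - a) / (b - a)"] by auto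
    then show ?thesis using f by simp
  qed (use f assms in simp)
qed

text \<open>Slopes multiply, and the length of the middle interval cancels because that interval is
  nondegenerate.\<close>

lemma affine_on_comp:
  assumes "affine_on f I J" "affine_on g J K" "fst I < snd I" "fst J < snd J"
  shows "affine_on (g \<circ> f) I K"
proof -
  obtain a b c d e h where [simp]: "I = (a, b)" "J = (c, d)" "K = (e, h)" by (cases I; cases J; cases K)
  have "g (f x) = e + (h - e) / (b - a) * (x - a)" if x: "x \<in> {a..b}" for x
  proof -
    have "f x \<in> {c..d}" using affine_on_maps_to[OF assms(1,4), of x] x by simp
    then have "g (f x) = e + (h - e) / (d - c) * (f x - c)" using assms(2) by simp
    also have "f x - c = (d - c) / (b - a) * (x - a)" using assms(1) x by simp
    finally show ?thesis using assms by simp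
  qed
  then show ?thesis by simp
qed

lemma list_all2_affine_on_comp:
  assumes "list_all2 (affine_on f) Is Js" "list_all2 (affine_on g) Js Ks"
    "\<forall>I\<in>set Is. fst I < snd I" "\<forall>J\<in>set Js. fst J < snd J"
  shows "list_all2 (affine_on (g \<circ> f)) Is Ks"
  using assms
proof (induction arbitrary: Ks rule: list_all2_induct)
  case (Cons I Is J Js)
  then show ?case
    using affine_on_comp[of f I J g] by (auto simp: list_all2_Cons1 o_def simp del: affine_on.simps)
qed simp

lemma list_all2_affine_on_cong:
  assumes "list_all2 (affine_on f) Is Js" "chain a b Is" "\<And>x. x \<in> {a..b} \<Longrightarrow> f x = g x"
  shows "list_all2 (affine_on g) Is Js"
  using assms(1)
proof (rule list.rel_mono_strong)
  fix I J assume I: "I \<in> set Is" and f: "affine_on f I J"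
  obtain u v c d where [simp]: "I = (u, v)" "J = (c, d)" by (cases I; cases J)
  show "affine_on g I J" using f chain_bounds[OF assms(2) I] assms(3) by simp
qed

lemma list_all2_affine_on_unique:
  assumes "list_all2 (affine_on f) Is Js" "list_all2 (affine_on g) Is Js"
    "chain a b Is" "Is \<noteq> []" "x \<in> {a..b}"
  shows "f x = g x"
proof -
  obtain I where I: "I \<in> set Is" "x \<in> {fst I..snd I}" using chain_cover assms by blast
  then obtain i where "i < length Is" "Is ! i = I" by (auto simp: in_set_conv_nth)
  then have "affine_on f I (Js ! i)" "affine_on g I (Js ! i)"
    using assms(1,2) by (auto simp: list_all2_conv_all_nth)
  then show ?thesis using I by (cases I; cases "Js ! i") auto
qed

text \<open>Strict monotonicity and continuity are glued at the junction \<open>snd I\<close>. The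
  hypothesis \<open>f a = c\<close> passes the value at the junction to the tail; when no intervals
  remain, it is all that is known about \<open>f\<close>.\<close>

lemma affine_on_chain:
  assumes "list_all2 (affine_on f) Is Js" "chain a b Is" "chain c d Js" "f a = c"
  shows "f b = d \<and> strict_mono_on {a..b} f \<and> continuous_on {a..b} f"
  using assms
proof (induction arbitrary: a c rule: list_all2_induct)
  case Nil
  then show ?case by (auto simp: strict_mono_on_def)
next
  case (Cons I Is J Js)
  have I: "fst I = a" "a < snd I" and J: "fst J = c" "c < snd J" using Cons.prems by auto
  note m = affine_on_endpoints[OF Cons.hyps(1)]
  have IH: "f b = d" "strict_mono_on {snd I..b} f" "continuous_on {snd I..b} f"
    using Cons.IH[of "snd I" "snd J"] Cons.prems m by auto
  have b: "snd I \<le> b" using Cons.prems chain_le by auto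
  have l: "f x < f y" if "a \<le> x" "x < y" "y \<le> snd I" for x y
    using affine_on_mono[OF Cons.hyps(1)] I J that by auto
  have r: "f x < f y" if "snd I \<le> x" "x < y" "y \<le> b" for x y
    using strict_mono_onD[OF IH(2), of x y] that by auto
  have "f x < f y" if "a \<le> x" "x < y" "y \<le> b" for x y
  proof (cases "x < snd I \<and> snd I < y")
    case True
    then show ?thesis using l[of x "snd I"] r[of "snd I" y] that by auto
  next
    case False
    then show ?thesis using l r that by (cases "snd I < y") auto
  qed
  then have mono: "strict_mono_on {a..b} f" by (auto simp: strict_mono_on_def)
  have "continuous_on {a..snd I} (\<lambda>x. c + (snd J - c) / (snd I - a) * (x - a))"
    by (intro continuous_intros)
  then have "continuous_on {a..snd I} f"
    by (rule continuous_on_eq) (use Cons.hyps(1) I J in \<open>cases I; cases J; auto\<close>)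
  then have "continuous_on ({a..snd I} \<union> {snd I..b}) f"
    using IH by (intro continuous_on_closed_Un) auto
  then show ?case using IH mono I b by (auto simp: ivl_disj_un_two_touch)
qed

text \<open>The value at the left end is part of the conclusion so that, in the induction, the map
  built for the tail meets the first affine piece at \<open>snd I\<close>.\<close>

lemma affine_on_chain_exists:
  assumes "chain a b Is" "chain c d Js" "length Is = length Js"
  shows "\<exists>f. f a = c \<and> list_all2 (affine_on f) Is Js"
  using assms(3,1,2)
proof (induction arbitrary: a c rule: list_induct2)
  case Nil
  then show ?case by auto
next
  case (Cons I Is J Js)
  obtain f where f: "f (snd I) = snd J" "list_all2 (affine_on f) Is Js"
    using Cons.IH[of "snd I" "snd J"] Cons.prems by auto
  define g where "g x = (if x \<le> snd I then c + (snd J - c) / (snd I - a) * (x - a) else f x)" for x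
  have "f x = g x" if "x \<in> {snd I..b}" for x
    using that f(1) Cons.prems by (auto simp: g_def)
  then have "list_all2 (affine_on g) Is Js"
    using list_all2_affine_on_cong[OF f(2)] Cons.prems by auto
  moreover have "affine_on g I J" "g a = c"
    using Cons.prems by (cases I; cases J; auto simp: g_def)+
  ultimately show ?case by auto
qed

text \<open>Both \<open>g \<circ> f\<close> and the identity carry each interval of
  \<open>Is\<close> affinely to itself, so they agree by \<open>list_all2_affine_on_unique\<close>;
  likewise for \<open>f \<circ> g\<close> on \<open>Js\<close>.\<close>

lemma affine_on_chain_bij:
  assumes f: "list_all2 (affine_on f) Is Js" "f a = c"
    and g: "list_all2 (affine_on g) Js Is" "g c = a"
    and Is: "chain a b Is" "Is \<noteq> []" and Js: "chain c d Js"
  shows "homeomorphism {a..b} {c..d} f g"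
proof -
  note F = affine_on_chain[OF f(1) Is(1) Js f(2)] and G = affine_on_chain[OF g(1) Js Is(1) g(2)]
  have "f a \<le> f x" "f x \<le> f b" if "x \<in> {a..b}" for x
    using strict_mono_on_leD[of "{a..b}" f a x] strict_mono_on_leD[of "{a..b}" f x b] F that by auto
  moreover have "g c \<le> g x" "g x \<le> g d" if "x \<in> {c..d}" for x
    using strict_mono_on_leD[of "{c..d}" g c x] strict_mono_on_leD[of "{c..d}" g x d] G that by auto
  ultimately have sub: "f ` {a..b} \<subseteq> {c..d}" "g ` {c..d} \<subseteq> {a..b}"
    using F G f(2) g(2) by force+
  have "Js \<noteq> []" using f(1) Is(2) by auto
  have id: "list_all2 (affine_on (\<lambda>x. x)) Ks Ks" if "chain u v Ks" for u v Ks
  proof (rule list.rel_refl_strong)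
    fix I assume "I \<in> set Ks"
    then have "fst I < snd I" using chain_bounds(2) that by blast
    then show "affine_on (\<lambda>x. x) I I" by (cases I) simp
  qed
  have nd: "\<forall>I\<in>set Is. fst I < snd I" "\<forall>J\<in>set Js. fst J < snd J"
    using chain_bounds(2) Is(1) Js by blast+
  have "g (f x) = x" if "x \<in> {a..b}" for x
    using list_all2_affine_on_unique[OF list_all2_affine_on_comp[OF f(1) g(1) nd] id[OF Is(1)] Is that]
    by simp
  moreover have "f (g x) = x" if "x \<in> {c..d}" for x
    using list_all2_affine_on_unique[OF list_all2_affine_on_comp[OF g(1) f(1) nd(2,1)] id[OF Js] Js
        \<open>Js \<noteq> []\<close> that]
    by simp
  ultimately show ?thesis
    using F G sub by (intro homeomorphismI) simp_all
qed

section \<open>Leaf intervals\<close>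

definition subdiv :: "nat \<Rightarrow> real \<Rightarrow> real \<Rightarrow> nat \<Rightarrow> real" where
  "subdiv p a b i = a + real i * (b - a) / real p"

lemma subdiv_simps [simp]: "subdiv p a b 0 = a" "p > 0 \<Longrightarrow> subdiv p a b p = b"
  by (auto simp: subdiv_def)

lemma subdiv_diff: "subdiv p a b (Suc i) - subdiv p a b i = (b - a) / real p"
  by (auto simp: subdiv_def field_simps add_divide_distrib diff_divide_distrib)

lemma subdiv_less: "a < b \<Longrightarrow> p > 0 \<Longrightarrow> subdiv p a b i < subdiv p a b (Suc i)"
  using subdiv_diff[of p a b i] by (smt (verit) divide_pos_pos of_nat_0_less_iff)

text \<open>Indexing the children by position replaces the \<open>map2\<close> of the definition, so
  that statements about the children can be combined by \<open>concat\<close> over a range of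
  indices.\<close>

lemma leaf_intervals_Caret:
  "leaf_intervals (Caret ts) a b =
    concat (map (\<lambda>i. leaf_intervals (ts ! i) (subdiv (length ts) a b i) (subdiv (length ts) a b (Suc i)))
      [0..<length ts])"
proof -
  have *: "map2 h [0..<length ts] (map leaf_intervals ts) = map (\<lambda>i. h i (leaf_intervals (ts ! i))) [0..<length ts]"
    for h :: "nat \<Rightarrow> (real \<Rightarrow> real \<Rightarrow> (real \<times> real) list) \<Rightarrow> (real \<times> real) list"
    by (rule nth_equalityI) auto
  show ?thesis by (simp add: * subdiv_def)
qed

declare leaf_intervals.simps(2) [simp del]

lemma length_leaf_intervals: "length (leaf_intervals t a b) = leaves t"
proof (induction t arbitrary: a b)
  case (Caret ts)
  have "length (leaf_intervals (Caret ts) a b) = sum_list (map (\<lambda>i. leaves (ts ! i)) [0..<length ts])"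
    by (auto simp: leaf_intervals_Caret length_concat o_def Caret.IH intro!: arg_cong[where f = sum_list])
  also have "map (\<lambda>i. leaves (ts ! i)) [0..<length ts] = map leaves ts"
    by (rule nth_equalityI) auto
  finally show ?case by simp
qed auto

lemma set_leaf_intervals_Caret:
  assumes "I \<in> set (leaf_intervals (Caret ts) a b)"
  obtains i where "i < length ts"
    "I \<in> set (leaf_intervals (ts ! i) (subdiv (length ts) a b i) (subdiv (length ts) a b (Suc i)))"
  using assms by (auto simp: leaf_intervals_Caret)

lemma chain_leaf_intervals:
  assumes "is_tree A t" "0 \<notin> A" "a < b"
  shows "chain a b (leaf_intervals t a b)"
  using assms
proof (induction t arbitrary: a b)
  case (Caret ts)
  let ?p = "length ts"
  have p: "?p > 0" using Caret.prems by (metis gr0I is_tree.simps(2))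
  have "chain (subdiv ?p a b 0) (subdiv ?p a b ?p) (leaf_intervals (Caret ts) a b)"
    unfolding leaf_intervals_Caret
    using Caret.prems p by (intro chain_concat Caret.IH) (auto intro: subdiv_less)
  then show ?case using p by simp
qed auto

text \<open>An affine map carries p equal parts to p equal parts with the same slope, hence the
  whole subdivision given by \<open>t\<close> to its copy. This allows the same tree to be attached
  to two corresponding leaves of a diagram without changing the map.\<close>

lemma affine_on_leaf_intervals:
  assumes "is_tree A t" "0 \<notin> A" "a < b" "affine_on f (a, b) (c, d)"
  shows "list_all2 (affine_on f) (leaf_intervals t a b) (leaf_intervals t c d)"
  using assms
proof (induction t arbitrary: a b c d)
  case (Caret ts)
  let ?p = "length ts"
  have p: "?p > 0" using Caret.prems by (metis gr0I is_tree.simps(2))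
  have "affine_on f (subdiv ?p a b i, subdiv ?p a b (Suc i)) (subdiv ?p c d i, subdiv ?p c d (Suc i))"
    if "i < ?p" for i
  proof -
    have "f x = subdiv ?p c d i + (d - c) / (b - a) * (x - subdiv ?p a b i)"
      if x: "x \<in> {subdiv ?p a b i..subdiv ?p a b (Suc i)}" for x
    proof -
      have "real (Suc i) * (b - a) / real ?p \<le> b - a"
        using \<open>i < ?p\<close> Caret.prems(3) p by (simp add: divide_simps)
      moreover have "0 \<le> real i * (b - a) / real ?p" using Caret.prems(3) by auto
      ultimately have "x \<in> {a..b}" using x by (auto simp: subdiv_def)
      then have "f x = c + (d - c) / (b - a) * (x - a)" using Caret.prems(4) by simp
      also have "\<dots> = subdiv ?p c d i + (d - c) / (b - a) * (x - subdiv ?p a b i)"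
        using Caret.prems(3) p by (simp add: subdiv_def field_simps)
      finally show ?thesis .
    qed
    then show ?thesis using p by (simp add: subdiv_diff)
  qed
  then have "list_all2 (affine_on f)
      (leaf_intervals (ts ! i) (subdiv ?p a b i) (subdiv ?p a b (Suc i)))
      (leaf_intervals (ts ! i) (subdiv ?p c d i) (subdiv ?p c d (Suc i)))" if "i < ?p" for i
    using Caret.prems p that by (intro Caret.IH) (auto intro: subdiv_less)
  then show ?case unfolding leaf_intervals_Caret
    by (intro concat_transfer[THEN rel_funD]) (auto simp: list_all2_conv_all_nth)
qed auto

lemma leaves_pos: "is_tree A t \<Longrightarrow> 0 \<notin> A \<Longrightarrow> leaves t > 0"
proof (induction t)
  case (Caret ts)
  then have "ts \<noteq> []" by auto
  then show ?case using Caret by (cases ts) auto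
qed auto

text \<open>A sibling exists and has at least one leaf. So the number of leaves drops at every step
  down the tree, and it bounds the depth.\<close>

lemma leaves_child_less:
  assumes "is_tree A (Caret ts)" "\<forall>q\<in>A. q \<ge> 2" "i < length ts"
  shows "leaves (ts ! i) < leaves (Caret ts)"
proof -
  have A: "0 \<notin> A" using assms(2) by force
  have pos: "leaves t > 0" if "t \<in> set ts" for t using leaves_pos[OF _ A] assms(1) that by auto
  obtain j where j: "j < length ts" "j \<noteq> i"
  proof -
    have "length ts \<ge> 2" using assms by auto
    then have "0 < length ts" "1 < length ts" by auto
    then show thesis using that by (cases "i = 0") auto
  qed
  have "leaves (Caret ts) = (\<Sum>l<length ts. leaves (ts ! l))"
    by (simp add: sum_list_sum_nth atLeast0LessThan)
  also have "\<dots> \<ge> (\<Sum>l\<in>{i, j}. leaves (ts ! l))"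
    using assms j by (intro sum_mono2) auto
  finally show ?thesis using j pos[of "ts ! j"] by simp
qed

text \<open>Each caret on the way down divides the length by at most \<open>M\<close>, and by
  \<open>leaves_child_less\<close> there are fewer such carets than leaves.\<close>

lemma leaf_interval_length_ge:
  assumes "is_tree A t" "\<forall>q\<in>A. 2 \<le> q \<and> q \<le> M" "a \<le> b" "I \<in> set (leaf_intervals t a b)"
  shows "snd I - fst I \<ge> (b - a) / real M ^ leaves t"
  using assms
proof (induction t arbitrary: a b)
  case Leaf
  \<comment> \<open>A leaf counts 1, so the claimed bound is \<open>(b - a) / M\<close>. If
    \<open>A\<close> is empty, \<open>M = 0\<close> is possible; the quotient is then 0.\<close>
  then have "(b - a) / real M \<le> b - a"
    using mult_left_mono[of 1 "real M" "b - a"] by (cases "M = 0") (auto simp: divide_simps)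
  then show ?case using Leaf by simp
next
  case (Caret ts)
  obtain i where i: "i < length ts"
    "I \<in> set (leaf_intervals (ts ! i) (subdiv (length ts) a b i) (subdiv (length ts) a b (Suc i)))"
    by (rule set_leaf_intervals_Caret[OF Caret.prems(4)])
  have p: "2 \<le> length ts" "length ts \<le> M" using Caret.prems by auto
  have lt: "leaves (ts ! i) < leaves (Caret ts)"
    using leaves_child_less[OF Caret.prems(1)] Caret.prems(2) i by auto
  have "(b - a) / real M ^ leaves (Caret ts) \<le> (b - a) / real M ^ Suc (leaves (ts ! i))"
    using Caret.prems(3) p lt
    by (intro divide_left_mono power_increasing) auto
  also have "\<dots> = (b - a) / real M / real M ^ leaves (ts ! i)" by simp
  also have "\<dots> \<le> (b - a) / real (length ts) / real M ^ leaves (ts ! i)"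
    using Caret.prems(3) p by (intro divide_right_mono divide_left_mono mult_pos_pos) auto
  also have "\<dots> \<le> snd I - fst I"
  proof -
    have "subdiv (length ts) a b i \<le> subdiv (length ts) a b (Suc i)"
      using subdiv_diff[of "length ts" a b i] Caret.prems(3)
      by (smt (verit) divide_nonneg_nonneg of_nat_0_le_iff)
    then show ?thesis
      using Caret.IH[of "ts ! i", OF _ _ Caret.prems(2) _ i(2)] i(1) Caret.prems(1)
      by (simp add: subdiv_diff)
  qed
  finally show ?case .
qed

section \<open>Diagrams represent elements of the group\<close>

lemma represents_iff:
  assumes "leaves (fst D) = leaves (snd D)"
  shows "represents D f \<longleftrightarrow> f \<in> extensional {0..1} \<and>
    list_all2 (affine_on f) (leaf_intervals (fst D) 0 1) (leaf_intervals (snd D) 0 1)"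
proof -
  have "(let (a, b) = I; (c, d) = J in \<forall>x\<in>{a..b}. f x = c + (d - c) / (b - a) * (x - a))
    \<longleftrightarrow> affine_on f I J" for I J
    by (cases I; cases J) simp
  then show ?thesis
    using assms by (simp add: represents_def leaf_interval_def list_all2_conv_all_nth length_leaf_intervals)
qed

lemma leaf_intervals_not_Nil: "is_tree A t \<Longrightarrow> 0 \<notin> A \<Longrightarrow> leaf_intervals t a b \<noteq> []"
  by (metis leaves_pos length_leaf_intervals length_greater_0_conv)

lemma is_diagram_swap: "is_diagram A D \<Longrightarrow> is_diagram A (prod.swap D)"
  by (auto simp: is_diagram_def)

lemma represents_start:
  assumes "is_diagram A D" "0 \<notin> A" "represents D f"
  shows "f 0 = 0"
proof -
  note D = assms(1)[unfolded is_diagram_def]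
  have "chain 0 1 (leaf_intervals (fst D) 0 1)" "chain 0 1 (leaf_intervals (snd D) 0 1)"
    using chain_leaf_intervals[OF _ assms(2)] D by auto
  moreover have "list_all2 (affine_on f) (leaf_intervals (fst D) 0 1) (leaf_intervals (snd D) 0 1)"
    using assms(3) D represents_iff by blast
  moreover have "leaf_intervals (fst D) 0 1 \<noteq> []" using leaf_intervals_not_Nil[OF _ assms(2)] D by auto
  moreover have "f a = c" if "list_all2 (affine_on f) Is Js" "chain a b Is" "chain c d Js" "Is \<noteq> []"
    for a b c d Is Js
    using that affine_on_endpoints(1)[of f "hd Is" "hd Js"] by (auto simp: neq_Nil_conv list_all2_Cons1)
  ultimately show ?thesis by blast
qed

text \<open>This gives the definite description in \<open>diagram_map\<close> its meaning. The leaf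
  intervals determine the map on \<open>{0..1}\<close>, and extensionality fixes it
  elsewhere.\<close>

lemma represents_ex1:
  assumes "is_diagram A D" "0 \<notin> A"
  shows "\<exists>!f. represents D f"
proof -
  note D = assms(1)[unfolded is_diagram_def]
  let ?Is = "leaf_intervals (fst D) 0 1" and ?Js = "leaf_intervals (snd D) 0 1"
  have Is: "chain 0 1 ?Is" and Js: "chain 0 1 ?Js" and ne: "?Is \<noteq> []"
    using chain_leaf_intervals[OF _ assms(2)] leaf_intervals_not_Nil[OF _ assms(2)] D by auto
  have rep: "represents D f \<longleftrightarrow> f \<in> extensional {0..1} \<and> list_all2 (affine_on f) ?Is ?Js" for f
    using represents_iff D by blast
  obtain f where "list_all2 (affine_on f) ?Is ?Js"
    using affine_on_chain_exists[OF Is Js] D by (auto simp: length_leaf_intervals)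
  then have "list_all2 (affine_on (restrict f {0..1})) ?Is ?Js"
    using list_all2_affine_on_cong[OF _ Is] by fastforce
  then have "represents D (restrict f {0..1})" unfolding rep by auto
  moreover have "g = h" if "represents D g" "represents D h" for g h
  proof (rule extensionalityI)
    show "g \<in> extensional {0..1}" "h \<in> extensional {0..1}" using that unfolding rep by blast+
    show "g x = h x" if "x \<in> {0..1}" for x
      using \<open>represents D g\<close> \<open>represents D h\<close> that list_all2_affine_on_unique[OF _ _ Is ne]
      unfolding rep by blast
  qed
  ultimately show ?thesis by blast
qed

lemma represents_homeomorphism:
  assumes "is_diagram A D" "0 \<notin> A" "represents D f" "represents (prod.swap D) g"
  shows "homeomorphism {0..1} {0..1} f g"
proof -
  note D = assms(1)[unfolded is_diagram_def]
  show ?thesis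
  proof (rule affine_on_chain_bij)
    show "chain 0 1 (leaf_intervals (fst D) 0 1)" "chain 0 1 (leaf_intervals (snd D) 0 1)"
      using chain_leaf_intervals[OF _ assms(2)] D by auto
    show "leaf_intervals (fst D) 0 1 \<noteq> []" using leaf_intervals_not_Nil[OF _ assms(2)] D by auto
    show "list_all2 (affine_on f) (leaf_intervals (fst D) 0 1) (leaf_intervals (snd D) 0 1)"
      "list_all2 (affine_on g) (leaf_intervals (snd D) 0 1) (leaf_intervals (fst D) 0 1)"
      using assms(3,4) D represents_iff[of D f] represents_iff[of "prod.swap D" g] by auto
    show "f 0 = 0" using represents_start assms(1-3) by blast
    show "g 0 = 0" using represents_start[OF is_diagram_swap[OF assms(1)] assms(2,4)] .
  qed
qed

section \<open>Breakpoints and slopes of a diagram\<close>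

lemma localized_ints_of_int: "of_int z \<in> localized_ints N"
  unfolding localized_ints_def by (auto intro!: exI[of _ z] exI[of _ "0 :: nat"])

lemma localized_ints_add:
  assumes "x \<in> localized_ints N" "y \<in> localized_ints N" "N > 0"
  shows "x + y \<in> localized_ints N"
proof -
  obtain a e b h where "x = of_int a / of_nat N ^ e" "y = of_int b / of_nat N ^ h"
    using assms(1,2) by (auto simp: localized_ints_def)
  then have "x + y = of_int (a * int N ^ h + b * int N ^ e) / of_nat N ^ (e + h)"
    using assms(3) by (simp add: add_frac_eq power_add)
  then show ?thesis unfolding localized_ints_def by blast
qed

lemma localized_ints_mult:
  assumes "x \<in> localized_ints N" "y \<in> localized_ints N"
  shows "x * y \<in> localized_ints N"
proof -
  obtain a e b h where "x = of_int a / of_nat N ^ e" "y = of_int b / of_nat N ^ h"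
    using assms by (auto simp: localized_ints_def)
  then have "x * y = of_int (a * b) / of_nat N ^ (e + h)" by (simp add: power_add)
  then show ?thesis unfolding localized_ints_def by blast
qed

lemma localized_ints_inverse:
  assumes "q dvd N" "N > 0"
  shows "1 / real q \<in> localized_ints N"
proof -
  obtain r where "N = q * r" using assms by blast
  then have "1 / real q = of_int (int r) / of_nat N ^ 1" using assms by auto
  then show ?thesis unfolding localized_ints_def by blast
qed

locale tree_group =
  fixes k :: nat and n :: "nat \<Rightarrow> nat"
  assumes k_ge: "k \<ge> 1"
    and arity_ge: "j \<in> {1..k} \<Longrightarrow> n j \<ge> 2"
    and arity_dvd: "j \<in> {1..k} \<Longrightarrow> (n 1 - 1) dvd (n j - 1)"
begin

abbreviation "caret_types \<equiv> n ` {1..k}"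

definition "arity_prod = (\<Prod>j=1..k. n j)"

lemma arity_prod_pos: "arity_prod > 0"
  unfolding arity_prod_def using arity_ge by (fastforce intro: prod_pos)

lemma arity_dvd_prod: "q \<in> caret_types \<Longrightarrow> q dvd arity_prod"
  unfolding arity_prod_def by (auto intro: dvd_prodI)

lemma arity_bounds: "q \<in> caret_types \<Longrightarrow> 2 \<le> q \<and> q \<le> arity_prod"
  using arity_ge arity_dvd_prod arity_prod_pos by (auto intro: dvd_imp_le)

lemma zero_notin_caret_types: "0 \<notin> caret_types"
  using arity_bounds by force

lemma slope_group_1: "1 \<in> slope_group k n"
  unfolding slope_group_def by (auto intro!: exI[of _ "\<lambda>_. 0"])

lemma slope_group_divide:
  assumes "s \<in> slope_group k n" "t \<in> slope_group k n"
  shows "s / t \<in> slope_group k n"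
proof -
  obtain e h where "s = (\<Prod>j=1..k. real (n j) powi e j)" "t = (\<Prod>j=1..k. real (n j) powi h j)"
    using assms by (auto simp: slope_group_def)
  moreover have "real (n j) powi e j / real (n j) powi h j = real (n j) powi (e j - h j)"
    if "j \<in> {1..k}" for j
    using arity_ge[OF that] by (simp add: power_int_diff)
  ultimately have "s / t = (\<Prod>j=1..k. real (n j) powi (e j - h j))"
    by (simp add: prod_dividef[symmetric])
  then show ?thesis unfolding slope_group_def by (auto intro!: exI[of _ "\<lambda>j. e j - h j"])
qed

lemma slope_group_arity: "q \<in> caret_types \<Longrightarrow> real q \<in> slope_group k n"
proof -
  assume "q \<in> caret_types"
  then obtain i where i: "i \<in> {1..k}" "q = n i" by blast
  have "(\<Prod>j=1..k. real (n j) powi (if j = i then 1 else 0)) = (\<Prod>j=1..k. if j = i then real (n j) else 1)"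
    by (intro prod.cong) auto
  also have "\<dots> = real q" using i by (simp add: prod.delta)
  finally show ?thesis
    unfolding slope_group_def by (auto intro!: exI[of _ "\<lambda>j. if j = i then 1 else 0"])
qed

lemma leaf_intervals_slope_group:
  assumes "is_tree caret_types t" "b - a \<in> slope_group k n" "I \<in> set (leaf_intervals t a b)"
  shows "snd I - fst I \<in> slope_group k n"
  using assms
proof (induction t arbitrary: a b)
  case (Caret ts)
  obtain i where i: "i < length ts"
    "I \<in> set (leaf_intervals (ts ! i) (subdiv (length ts) a b i) (subdiv (length ts) a b (Suc i)))"
    by (rule set_leaf_intervals_Caret[OF Caret.prems(3)])
  show ?case
    using Caret.IH[OF _ _ _ i(2)] i(1) Caret.prems
    by (simp add: subdiv_diff slope_group_divide slope_group_arity)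
qed auto

lemma leaf_intervals_localized_ints:
  assumes "is_tree caret_types t" "a \<in> localized_ints arity_prod" "b \<in> localized_ints arity_prod"
    "I \<in> set (leaf_intervals t a b)"
  shows "fst I \<in> localized_ints arity_prod \<and> snd I \<in> localized_ints arity_prod"
  using assms
proof (induction t arbitrary: a b)
  case (Caret ts)
  obtain i where i: "i < length ts"
    "I \<in> set (leaf_intervals (ts ! i) (subdiv (length ts) a b i) (subdiv (length ts) a b (Suc i)))"
    by (rule set_leaf_intervals_Caret[OF Caret.prems(4)])
  have inverse: "1 / real (length ts) \<in> localized_ints arity_prod"
    using Caret.prems(1) arity_prod_pos by (intro localized_ints_inverse arity_dvd_prod) auto
  have "subdiv (length ts) a b l \<in> localized_ints arity_prod" for l
  proof -
    have "a + of_int (int l) * (b + of_int (- 1) * a) * (1 / real (length ts)) \<in> localized_ints arity_prod"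
      by (intro localized_ints_add localized_ints_mult localized_ints_of_int inverse
          Caret.prems(2,3) arity_prod_pos)
    then show ?thesis by (simp add: subdiv_def)
  qed
  then show ?case using Caret.IH[OF _ _ _ _ i(2)] i(1) Caret.prems(1) by simp
qed auto

lemma diagram_pl:
  assumes "is_diagram caret_types D" "represents D f"
  shows "pl_with (localized_ints arity_prod) (slope_group k n) f"
proof -
  note D = assms(1)[unfolded is_diagram_def]
  let ?Is = "leaf_intervals (fst D) 0 1" and ?Js = "leaf_intervals (snd D) 0 1"
  let ?B = "fst ` set ?Is \<union> snd ` set ?Is"
  have Is: "chain 0 1 ?Is" and ne: "?Is \<noteq> []"
    using chain_leaf_intervals[OF _ zero_notin_caret_types] leaf_intervals_not_Nil[OF _ zero_notin_caret_types] D
    by auto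
  have f: "list_all2 (affine_on f) ?Is ?Js" using represents_iff D assms(2) by blast
  have "(0::real) \<in> localized_ints arity_prod" "(1::real) \<in> localized_ints arity_prod"
    using localized_ints_of_int[of 0] localized_ints_of_int[of 1] by simp_all
  then have "fst I \<in> localized_ints arity_prod \<and> snd I \<in> localized_ints arity_prod"
    if "I \<in> set ?Is" for I
    using leaf_intervals_localized_ints[of "fst D" 0 1 I] D that by blast
  moreover have "fst I \<in> {0..1} \<and> snd I \<in> {0..1}" if "I \<in> set ?Is" for I
    using chain_bounds[OF Is that] by simp
  ultimately have B: "?B \<subseteq> localized_ints arity_prod \<inter> {0..1}" by blast
  have affine: "\<exists>s\<in>slope_group k n. \<exists>c. \<forall>x\<in>{a..b}. f x = s * x + c"
    if ab: "0 \<le> a" "a < b" "b \<le> 1" "{a<..<b} \<inter> ?B = {}" for a b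
  proof -
    \<comment> \<open>The midpoint selects a leaf interval. Its end points lie in \<open>?B\<close>
      and hence outside the open interval from \<open>a\<close> to \<open>b\<close>, so it contains
      all of \<open>{a..b}\<close>.\<close>
    obtain I where I: "I \<in> set ?Is" "(a + b) / 2 \<in> {fst I..snd I}"
      using chain_cover[OF Is ne, of "(a + b) / 2"] ab by auto
    then obtain i where i: "i < length ?Is" "I = ?Is ! i" by (auto simp: in_set_conv_nth)
    obtain u v where uv: "I = (u, v)" by (cases I)
    obtain c d where cd: "?Js ! i = (c, d)" by (cases "?Js ! i")
    have "u \<notin> {a<..<b}" "v \<notin> {a<..<b}" using ab(4) imageI[OF I(1), of fst] imageI[OF I(1), of snd] unfolding uv fst_conv snd_conv by blast+
    then have sub: "{a..b} \<subseteq> {u..v}" using I(2) ab(2) uv by (auto simp: field_simps)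
    have "affine_on f I (?Js ! i)" using f i by (auto simp: list_all2_conv_all_nth)
    then have fx: "f x = c + (d - c) / (v - u) * (x - u)" if "x \<in> {a..b}" for x
      using that sub uv cd by auto
    \<comment> \<open>The slope is a quotient of two leaf lengths, and each leaf length arises from
      1 by dividing by caret types.\<close>
    have "(c, d) \<in> set ?Js" using i f cd by (metis list_all2_lengthD nth_mem)
    then have "d - c \<in> slope_group k n"
      using leaf_intervals_slope_group[of "snd D" 1 0 "(c, d)"] slope_group_1 D by simp
    moreover have "v - u \<in> slope_group k n"
      using leaf_intervals_slope_group[of "fst D" 1 0 "(u, v)"] slope_group_1 D I uv by simp
    ultimately have "(d - c) / (v - u) \<in> slope_group k n" by (rule slope_group_divide)
    moreover have "f x = (d - c) / (v - u) * x + (c - (d - c) / (v - u) * u)" if "x \<in> {a..b}" for x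
      using fx[OF that] by (simp only: right_diff_distrib)
    ultimately show ?thesis by blast
  qed
  have "finite ?B" by simp
  then show ?thesis
    unfolding pl_with_def by (intro exI[of _ ?B] conjI allI impI, use B in blast, use B in blast)
      (elim conjE, rule affine)
qed

lemma diagram_in_F:
  assumes "is_diagram caret_types D" "represents D f"
  shows "f \<in> F_elements k n"
proof -
  note D = assms(1)[unfolded is_diagram_def]
  obtain g where "represents (prod.swap D) g"
    using represents_ex1[OF is_diagram_swap[OF assms(1)] zero_notin_caret_types] by blast
  then have hom: "homeomorphism {0..1} {0..1} f g"
    using represents_homeomorphism assms zero_notin_caret_types by blast
  have f: "f \<in> extensional {0..1}" "list_all2 (affine_on f) (leaf_intervals (fst D) 0 1) (leaf_intervals (snd D) 0 1)"
    using represents_iff D assms(2) by blast+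
  have "strict_mono_on {0..1} f"
    using affine_on_chain[OF f(2) chain_leaf_intervals[OF _ zero_notin_caret_types]
        chain_leaf_intervals[OF _ zero_notin_caret_types]
        represents_start[OF assms(1) zero_notin_caret_types assms(2)]] D by simp
  then show ?thesis
    using f(1) hom diagram_pl[OF assms] by (auto simp: F_elements_def arity_prod_def)
qed

section \<open>Products and inverses in the group\<close>

lemma F_elements_Bij: "F_elements k n \<subseteq> Bij {0..1}"
proof
  fix f assume f: "f \<in> F_elements k n"
  then obtain g where "homeomorphism {0..1} {0..1} f g" by (auto simp: F_elements_def)
  then have "bij_betw f {0..1} {0..1}"
    unfolding homeomorphism_def by (intro bij_betw_byWitness[where f' = g]) auto
  then show "f \<in> Bij {0..1}" using f by (auto simp: F_elements_def Bij_def)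
qed

text \<open>The multiplication of \<open>BijGroup\<close> is restricted to \<open>Bij\<close>, so it
  is known to be composition only for arguments there. This is why membership in \<open>Bij\<close>
  is carried along with every product below.\<close>

lemma carrier_F_group [simp]: "carrier (F_group k n) = F_elements k n"
  and one_F_group [simp]: "\<one>\<^bsub>F_group k n\<^esub> = (\<lambda>x\<in>{0..1}. x)"
  and mult_F_group: "f \<in> Bij {0..1} \<Longrightarrow> g \<in> Bij {0..1} \<Longrightarrow> f \<otimes>\<^bsub>F_group k n\<^esub> g = compose {0..1} f g"
  by (auto simp: F_group_def BijGroup_def)

text \<open>\<open>m_inv\<close> is a definite description over the carrier, so a two-sided inverse
  and its uniqueness are both required. The swapped diagram supplies the inverse, and uniqueness is
  the usual h = (g f) h = g (f h) = g, computed with \<open>compose\<close>.\<close>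

lemma diagram_inverse:
  assumes "is_diagram caret_types D" "represents D f" "represents (prod.swap D) g"
  shows "inv\<^bsub>F_group k n\<^esub> f = g"
proof -
  have hom: "homeomorphism {0..1} {0..1} f g"
    using represents_homeomorphism assms zero_notin_caret_types by blast
  have fg: "f \<in> F_elements k n" "g \<in> F_elements k n"
    using diagram_in_F[OF assms(1,2)] diagram_in_F[OF is_diagram_swap[OF assms(1)] assms(3)] by simp_all
  then have Bij: "f \<in> Bij {0..1}" "g \<in> Bij {0..1}" using F_elements_Bij by auto
  have inv: "compose {0..1} f g = (\<lambda>x\<in>{0..1}. x)" "compose {0..1} g f = (\<lambda>x\<in>{0..1}. x)"
    unfolding compose_def
    by (rule restrict_ext, rule homeomorphism_apply2[OF hom] homeomorphism_apply1[OF hom], assumption)+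
  have "h = g" if h: "h \<in> F_elements k n" "f \<otimes>\<^bsub>F_group k n\<^esub> h = \<one>\<^bsub>F_group k n\<^esub>" for h
  proof -
    have "h \<in> Bij {0..1}" using h(1) F_elements_Bij by blast
    then have maps: "h \<in> {0..1} \<rightarrow> {0..1}" "h \<in> extensional {0..1}" "g \<in> {0..1} \<rightarrow> {0..1}" "g \<in> extensional {0..1}"
      using Bij(2) by (simp_all only: Bij_imp_funcset Bij_imp_extensional)
    have "h = compose {0..1} (compose {0..1} g f) h"
      unfolding inv(2) using maps(1,2) by (simp only: Id_compose)
    also have "\<dots> = compose {0..1} g (compose {0..1} f h)"
      using maps(1) by (simp only: compose_assoc)
    also have "compose {0..1} f h = (\<lambda>x\<in>{0..1}. x)"
      using h(2) mult_F_group[OF Bij(1) \<open>h \<in> Bij {0..1}\<close>] by (simp only: one_F_group)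
    also have "compose {0..1} g \<dots> = g"
      using maps(3,4) by (simp only: compose_Id)
    finally show ?thesis .
  qed
  then show ?thesis
    unfolding m_inv_def
    by (intro the_equality) (simp_all only: carrier_F_group one_F_group mult_F_group Bij inv fg simp_thms)
qed

section \<open>Germs at the left end point\<close>

text \<open>The slope at 0 as a relation, which also records \<open>f 0 = 0\<close>. The bound
  \<open>\<delta> \<le> 1\<close> keeps the interval inside \<open>{0..1}\<close>, where
  \<open>compose\<close> really composes.\<close>

definition germ :: "real \<Rightarrow> (real \<Rightarrow> real) \<Rightarrow> bool" where
  "germ s f \<longleftrightarrow> (\<exists>\<delta>>0. \<delta> \<le> 1 \<and> (\<forall>x\<in>{0..\<delta>}. f x = s * x))"

lemma germ_unique:
  assumes "germ s f" "germ t f"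
  shows "s = t"
proof -
  obtain \<delta> \<eta> where "\<delta> > 0" "\<eta> > 0" "\<forall>x\<in>{0..\<delta>}. f x = s * x" "\<forall>x\<in>{0..\<eta>}. f x = t * x"
    using assms by (auto simp: germ_def)
  moreover define x where "x = min \<delta> \<eta>"
  ultimately have "x \<in> {0..\<delta>}" "x \<in> {0..\<eta>}" "x > 0" "\<forall>x\<in>{0..\<delta>}. f x = s * x" "\<forall>x\<in>{0..\<eta>}. f x = t * x"
    by auto
  then have "s * x = t * x" "x > 0" by metis+
  then show ?thesis by simp
qed

text \<open>The slope at 0 is multiplicative. The radius \<open>min \<eta> (\<delta> / t)\<close>
  keeps \<open>x\<close> where \<open>g\<close> is linear and \<open>t * x\<close> where
  \<open>f\<close> is linear.\<close>

lemma germ_compose: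
  assumes "germ s f" "germ t g" "t > 0"
  shows "germ (s * t) (compose {0..1} f g)"
proof -
  obtain \<delta> \<eta> where d: "\<delta> > 0" "\<eta> > 0" "\<eta> \<le> 1" "\<forall>x\<in>{0..\<delta>}. f x = s * x" "\<forall>x\<in>{0..\<eta>}. g x = t * x"
    using assms by (auto simp: germ_def)
  have "compose {0..1} f g x = s * t * x" if "x \<in> {0..min \<eta> (\<delta> / t)}" for x
  proof -
    have "t * x \<in> {0..\<delta>}" using that assms(3) by (auto simp: field_simps)
    then show ?thesis using that d by (auto simp: compose_def)
  qed
  then show ?thesis unfolding germ_def using d assms(3)
    by (intro exI[of _ "min \<eta> (\<delta> / t)"]) auto
qed

lemma germ_id: "germ 1 (\<lambda>x\<in>{0..1}. x)"
  unfolding germ_def by (intro exI[of _ 1]) auto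

text \<open>The leftmost leaf intervals are \<open>(0, b)\<close> and \<open>(0, d)\<close>, so the
  slope is \<open>d / b\<close>, which is at least \<open>d\<close> since \<open>b \<le> 1\<close>.
  The bound serves twice: it makes the slopes of the generators positive, and it bounds the leaf
  number of the powers from below.\<close>

lemma represents_germ:
  assumes "is_diagram caret_types D" "represents D f"
  shows "\<exists>s. germ s f \<and> s \<ge> 1 / real arity_prod ^ leaves (fst D)"
proof -
  note D = assms(1)[unfolded is_diagram_def]
  let ?Is = "leaf_intervals (fst D) 0 1" and ?Js = "leaf_intervals (snd D) 0 1"
  have Is: "chain 0 1 ?Is" "chain 0 1 ?Js" and ne: "?Is \<noteq> []"
    using chain_leaf_intervals[OF _ zero_notin_caret_types] leaf_intervals_not_Nil[OF _ zero_notin_caret_types] D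
    by auto
  have "list_all2 (affine_on f) ?Is ?Js" using represents_iff D assms(2) by blast
  then obtain I Is' J Js' where IJ: "?Is = I # Is'" "?Js = J # Js'" "affine_on f I J"
    using ne by (metis list.exhaust list_all2_Cons1)
  obtain b d where I: "I = (0, b)" and J: "J = (0, d)" using Is IJ by (cases I; cases J) auto
  have b: "0 < b" "b \<le> 1" using chain_bounds[OF Is(1), of I] IJ I by auto
  have d: "0 < d" using Is(2) IJ J by simp
  have "1 / real arity_prod ^ leaves (snd D) \<le> d"
    using leaf_interval_length_ge[of caret_types "snd D" arity_prod 0 1 J] D IJ J arity_bounds by auto
  also have "d \<le> d / b" using b d by (simp add: divide_simps)
  finally have "1 / real arity_prod ^ leaves (fst D) \<le> d / b" using D by simp
  moreover have "germ (d / b) f" unfolding germ_def using b IJ(3) I J by (intro exI[of _ b]) auto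
  ultimately show ?thesis by blast
qed

text \<open>Only a lower bound on the slope of each letter is followed, because the elements to be
  measured have very small slope at 0. The exponent grows by \<open>r\<close> with each
  letter.\<close>

lemma foldr_germ:
  assumes "\<And>g. g \<in> set u \<Longrightarrow> g \<in> Bij {0..1} \<and> (\<exists>s\<ge>q ^ r. germ s g)" "q > 0"
  shows "foldr (mult (F_group k n)) u \<one>\<^bsub>F_group k n\<^esub> \<in> Bij {0..1} \<and>
    (\<exists>s\<ge>q ^ (r * length u). germ s (foldr (mult (F_group k n)) u \<one>\<^bsub>F_group k n\<^esub>))"
  using assms(1)
proof (induction u)
  case Nil
  have "(\<lambda>x\<in>{0..1::real}. x) \<in> Bij {0..1}" by (rule id_Bij)
  then show ?case using germ_id by (auto simp del: restrict_apply)
next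
  case (Cons g u)
  let ?h = "foldr (mult (F_group k n)) u \<one>\<^bsub>F_group k n\<^esub>"
  obtain t where h: "?h \<in> Bij {0..1}" "germ t ?h" "q ^ (r * length u) \<le> t"
    using Cons by (auto simp del: one_F_group)
  obtain s where g: "g \<in> Bij {0..1}" "germ s g" "q ^ r \<le> s" using Cons.prems[of g] by auto
  have pos: "t > 0" "s > 0"
    using h(3) g(3) zero_less_power[OF assms(2)] less_le_trans by blast+
  then have "germ (s * t) (compose {0..1} g ?h)" using germ_compose g h by blast
  moreover have "q ^ (r * length (g # u)) \<le> s * t"
    using mult_mono[OF g(3) h(3)] assms(2) pos by (simp add: power_add)
  ultimately show ?case using g h by (auto simp: mult_F_group compose_Bij simp del: one_F_group)
qed

end

section \<open>Strings\<close>

fun left_string :: "nat \<Rightarrow> nat \<Rightarrow> ctree" where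
  "left_string m 0 = Leaf"
| "left_string m (Suc c) = Caret (left_string m c # replicate (m - 1) Leaf)"

lemma leaves_strings:
  assumes "m \<ge> 1"
  shows "leaves (right_string m c) = c * (m - 1) + 1" "leaves (left_string m c) = c * (m - 1) + 1"
  by (induction c) (auto simp: sum_list_replicate)

lemma is_tree_strings:
  assumes "m \<in> A" "m \<ge> 1"
  shows "is_tree A (right_string m c)" "is_tree A (left_string m c)"
  using assms by (induction c) auto

lemma length_attach_list: "length (attach_list m i ts) = length ts"
  by (induction ts arbitrary: i) auto

lemma leaves_attach:
  assumes "m \<ge> 1"
  shows "i < leaves t \<Longrightarrow> leaves (attach m i t) = leaves t + (m - 1)"
    and "i < sum_list (map leaves ts) \<Longrightarrow>
      sum_list (map leaves (attach_list m i ts)) = sum_list (map leaves ts) + (m - 1)"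
  using assms by (induction m i t and m i ts rule: attach_attach_list.induct) (auto simp: sum_list_replicate)

lemma is_tree_attach:
  assumes "m \<in> A"
  shows "is_tree A t \<Longrightarrow> is_tree A (attach m i t)"
    and "\<forall>t\<in>set ts. is_tree A t \<Longrightarrow> \<forall>t\<in>set (attach_list m i ts). is_tree A t"
  using assms
  by (induction m i t and m i ts rule: attach_attach_list.induct) (auto simp: length_attach_list)

definition subintervals :: "nat \<Rightarrow> real \<Rightarrow> real \<Rightarrow> nat \<Rightarrow> nat \<Rightarrow> (real \<times> real) list" where
  "subintervals p a b i j = map (\<lambda>l. (subdiv p a b l, subdiv p a b (Suc l))) [i..<j]"

lemma concat_map_singleton: "concat (map (\<lambda>x. [f x]) xs) = map f xs"
  by (induction xs) auto

lemma leaf_intervals_right_string_Suc: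
  assumes "p \<ge> 1"
  shows "leaf_intervals (right_string p (Suc c)) a b =
    subintervals p a b 0 (p - 1) @ leaf_intervals (right_string p c) (subdiv p a b (p - 1)) b"
proof -
  let ?ts = "replicate (p - 1) Leaf @ [right_string p c]"
  have len: "length ?ts = p" using assms by simp
  have upt: "[0..<p] = [0..<p - 1] @ [p - 1]" using assms by (metis One_nat_def Suc_pred upt_Suc_append le0 less_eq_Suc_le)
  have init: "map (\<lambda>i. leaf_intervals (?ts ! i) (subdiv p a b i) (subdiv p a b (Suc i))) [0..<p - 1]
    = map (\<lambda>i. [(subdiv p a b i, subdiv p a b (Suc i))]) [0..<p - 1]"
    by (intro map_cong) (auto simp: nth_append)
  have "?ts ! (p - 1) = right_string p c" by (simp add: nth_append)
  then show ?thesis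
    unfolding right_string.simps leaf_intervals_Caret len unfolding upt map_append init
    using assms by (simp add: concat_map_singleton subintervals_def)
qed

lemma leaf_intervals_left_string_Suc:
  assumes "p \<ge> 1"
  shows "leaf_intervals (left_string p (Suc c)) a b =
    leaf_intervals (left_string p c) a (subdiv p a b 1) @ subintervals p a b 1 p"
proof -
  let ?ts = "left_string p c # replicate (p - 1) Leaf"
  have len: "length ?ts = p" using assms by simp
  have upt: "[0..<p] = 0 # [1..<p]" using assms by (simp add: upt_conv_Cons)
  have tail: "map (\<lambda>i. leaf_intervals (?ts ! i) (subdiv p a b i) (subdiv p a b (Suc i))) [1..<p]
    = map (\<lambda>i. [(subdiv p a b i, subdiv p a b (Suc i))]) [1..<p]"
    by (intro map_cong) (auto simp: nth_Cons')
  show ?thesis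
    unfolding left_string.simps leaf_intervals_Caret len unfolding upt list.map tail
    by (simp add: concat_map_singleton subintervals_def)
qed

text \<open>\<open>right_string\<close> grows at the root by definition; here it grows at its last
  leaf \<open>(e, b)\<close> instead. This is the form in which a diagram is refined during
  composition.\<close>

lemma right_string_snoc:
  assumes "p \<ge> 1"
  shows "\<exists>Is e. leaf_intervals (right_string p c) a b = Is @ [(e, b)] \<and>
    leaf_intervals (right_string p (Suc c)) a b = Is @ leaf_intervals (right_string p 1) e b"
proof (induction c arbitrary: a)
  case 0
  then show ?case by (auto intro!: exI[of _ "[]"])
next
  case (Suc c)
  let ?a = "subdiv p a b (p - 1)"
  obtain Is e where "leaf_intervals (right_string p c) ?a b = Is @ [(e, b)]"
    "leaf_intervals (right_string p (Suc c)) ?a b = Is @ leaf_intervals (right_string p 1) e b"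
    using Suc by blast
  then show ?case
    unfolding leaf_intervals_right_string_Suc[OF assms, of "Suc c"]
    unfolding leaf_intervals_right_string_Suc[OF assms, of c a]
    by (intro exI[of _ "subintervals p a b 0 (p - 1) @ Is"] exI[of _ e]) simp
qed

text \<open>
  The last leaf of the left string is subdivided so that the range of \<open>f\<close> becomes the domain
  of \<open>g\<close> with its first leaf replaced by a left string of \<open>m\<close> carets.
\<close>

lemma string_pairs_comp:
  assumes p: "p \<ge> 2"
    and f: "list_all2 (affine_on f) (leaf_intervals (right_string p (Suc m)) 0 1)
      (leaf_intervals (left_string p (Suc m)) 0 1)"
    and g: "list_all2 (affine_on g) (leaf_intervals (right_string p 2) 0 1)
      (leaf_intervals (left_string p 2) 0 1)"
  shows "list_all2 (affine_on (g \<circ> f)) (leaf_intervals (right_string p (Suc (Suc m))) 0 1)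
      (leaf_intervals (left_string p (Suc (Suc m))) 0 1)"
proof -
  have p1: "p \<ge> 1" and A: "0 \<notin> {p}" using p by auto
  note trees = is_tree_strings[of p "{p}", OF singletonI p1]
  \<comment> \<open>For one caret over \<open>{0..1}\<close>, the first child ends at
    \<open>h\<close> = 1/p and the last begins at \<open>e'\<close> = 1 - 1/p. The p - 2 children
    between them form \<open>?mid\<close>, which is empty for p = 2.\<close>
  define h e' where "h = subdiv p 0 1 1" and "e' = subdiv p 0 1 (p - 1)"
  let ?mid = "subintervals p 0 1 1 (p - 1)" and ?caret = "leaf_intervals (right_string p 1)"
  let ?Q = "leaf_intervals (left_string p m) 0 h @ ?mid"
  have h: "0 < h" unfolding h_def using subdiv_less[of 0 1 p 0] p by simp
  have e': "e' < 1" unfolding e'_def using subdiv_less[of 0 1 p "p - 1"] p by simp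
  have upt: "[1..<p] = [1..<p - 1] @ [p - 1]"
    using upt_Suc_append[of 1 "p - 1"] p by simp
  have last: "subintervals p 0 1 1 p = ?mid @ [(e', 1)]"
    unfolding subintervals_def e'_def upt using p by simp
  have first: "subintervals p 0 1 0 (p - 1) = (0, h) # ?mid"
    unfolding subintervals_def h_def using p by (simp add: upt_conv_Cons)
  obtain Is e where Is: "leaf_intervals (right_string p (Suc m)) 0 1 = Is @ [(e, 1)]"
    "leaf_intervals (right_string p (Suc (Suc m))) 0 1 = Is @ ?caret e 1"
    using right_string_snoc[OF p1] by blast
  have chain: "chain 0 1 (Is @ [(e, 1)])" "chain 0 1 (Is @ ?caret e 1)"
    unfolding Is[symmetric] by (rule chain_leaf_intervals[OF trees(1) A]; simp)+
  have e: "e < 1" using chain(1) by (auto simp: chain_append)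
  have "list_all2 (affine_on f) (Is @ [(e, 1)]) (?Q @ [(e', 1)])"
    using f unfolding Is(1) leaf_intervals_left_string_Suc[OF p1] h_def[symmetric] last by simp
  moreover from list_all2_lengthD[OF this] have "length Is = length ?Q" by simp
  ultimately have "list_all2 (affine_on f) Is ?Q" "affine_on f (e, 1) (e', 1)"
    using list_all2_append[of Is ?Q "affine_on f" "[(e, 1)]" "[(e', 1)]"]
    by (simp_all del: affine_on.simps append_assoc)
  \<comment> \<open>A caret is attached to the last leaf on both sides, which leaves
    \<open>f\<close> unchanged.\<close>
  then have f': "list_all2 (affine_on f) (Is @ ?caret e 1) (?Q @ ?caret e' 1)"
    using affine_on_leaf_intervals[OF trees(1) A e] by (intro list_all2_appendI)
  \<comment> \<open>\<open>Js\<close> lists the leaves to the right of the leftmost grandchild of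
    the root. It is the same for every left string with at least two carets, so only the subtree
    below that grandchild varies.\<close>
  define Js where "Js = subintervals p 0 h 1 p @ subintervals p 0 1 1 p"
  have left: "leaf_intervals (left_string p (Suc (Suc l))) 0 1
    = leaf_intervals (left_string p l) 0 (subdiv p 0 h 1) @ Js" for l
    unfolding leaf_intervals_left_string_Suc[OF p1] h_def[symmetric] Js_def by simp
  have "leaf_intervals (right_string p 2) 0 1 = (0, h) # ?mid @ ?caret e' 1"
    unfolding numeral_2_eq_2 leaf_intervals_right_string_Suc[OF p1, of "Suc 0"] e'_def[symmetric] first
    by simp
  moreover have "leaf_intervals (left_string p 2) 0 1 = (0, subdiv p 0 h 1) # Js"
    using left[of 0] by (simp add: numeral_2_eq_2)
  ultimately have "affine_on g (0, h) (0, subdiv p 0 h 1)" "list_all2 (affine_on g) (?mid @ ?caret e' 1) Js"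
    using g by (simp_all del: affine_on.simps)
  \<comment> \<open>A left string of \<open>m\<close> carets is attached to the first leaf on both
    sides of the diagram of \<open>g\<close>. The new domain subdivision is exactly the refined
    range subdivision in \<open>f'\<close>.\<close>
  then have g': "list_all2 (affine_on g) (?Q @ ?caret e' 1) (leaf_intervals (left_string p (Suc (Suc m))) 0 1)"
    using affine_on_leaf_intervals[OF trees(2) A h] unfolding left append_assoc
    by (intro list_all2_appendI)
  have "chain 0 h (leaf_intervals (left_string p m) 0 h)" "chain e' 1 (?caret e' 1)"
    using chain_leaf_intervals[OF _ A] trees h e' by blast+
  moreover have "\<forall>I\<in>set ?mid. fst I < snd I"
    using subdiv_less[of 0 1 p] p by (auto simp: subintervals_def)
  ultimately have "\<forall>I\<in>set (?Q @ ?caret e' 1). fst I < snd I"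
    using chain_bounds(2) by (auto simp del: right_string.simps; blast)
  moreover have "\<forall>I\<in>set (Is @ ?caret e 1). fst I < snd I" using chain_bounds(2)[OF chain(2)] by blast
  ultimately show ?thesis
    unfolding Is(2) using list_all2_affine_on_comp[OF f' g'] by blast
qed

section \<open>Slopes of the generators at 0\<close>

context tree_group
begin

lemma first_arity: "n 1 \<in> caret_types" "n 1 \<ge> 2"
  using k_ge arity_ge[of 1] by auto

lemma over_right_string_diagram:
  assumes "j \<in> {1..k}" "i < leaves (right_string (n 1) c)"
  shows "is_diagram caret_types (over_right_string (n 1) (attach (n j) i (right_string (n 1) c)))"
proof -
  let ?T = "attach (n j) i (right_string (n 1) c)"
  have "is_tree caret_types ?T"
    using assms(1) first_arity by (intro is_tree_attach is_tree_strings) auto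
  moreover have "leaves ?T = c * (n 1 - 1) + 1 + (n j - 1)"
    using leaves_attach(1)[OF _ assms(2), of "n j"] arity_ge[OF assms(1)] first_arity leaves_strings(1)[of "n 1" c]
    by auto
  \<comment> \<open>Here divisibility enters: \<open>leaves ?T - 1\<close> is
    \<open>c * (n 1 - 1) + (n j - 1)\<close>.\<close>
  moreover from this have "(leaves ?T - 1) div (n 1 - 1) * (n 1 - 1) = leaves ?T - 1"
    using arity_dvd[OF assms(1)] by (intro dvd_div_mult_self) auto
  ultimately show ?thesis
    unfolding is_diagram_def over_right_string_def
    using first_arity is_tree_strings(1)[of "n 1" caret_types] leaves_strings(1)[of "n 1"] by simp
qed

lemma std_gens_diagram:
  assumes "g \<in> std_gens k n"
  obtains D where "is_diagram caret_types D" "represents D g"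
proof -
  have "\<exists>D. is_diagram caret_types D \<and> g = diagram_map D"
    using assms unfolding std_gens_def
  proof (elim UnE CollectE exE conjE)
    fix j i assume g: "g = y_gen n j i" and j: "j \<in> {2..k}"
    have "leaves (right_string (n 1) i) > 0" using leaves_strings(1) first_arity by simp
    then have "leaves (right_string (n 1) i) - 1 < leaves (right_string (n 1) i)" by simp
    moreover have "j \<in> {1..k}" using j by simp
    ultimately show ?thesis
      unfolding g y_gen_def Let_def using over_right_string_diagram by blast
  next
    fix j i assume g: "g = z_gen n j i" and j: "j \<in> {1..k}"
    \<comment> \<open>The right string in \<open>z_gen\<close> is long enough to have a leaf
      numbered \<open>i\<close>, so the caret really is attached.\<close>
    have "i < (i div (n 1 - 1) + 1) * (n 1 - 1) + 1"
      using dividend_less_div_times[of "n 1 - 1" i] first_arity by (simp add: add_ac)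
    moreover have "n 1 \<ge> 1" using first_arity by simp
    ultimately have "i < leaves (right_string (n 1) (i div (n 1 - 1) + 1))"
      by (simp only: leaves_strings(1))
    then show ?thesis
      unfolding g z_gen_def Let_def using j over_right_string_diagram by blast
  qed
  then show thesis
    using that theI'[OF represents_ex1[OF _ zero_notin_caret_types]] unfolding diagram_map_def by blast
qed

lemma std_gens_and_inverses_germ:
  assumes "g \<in> std_gens k n \<union> m_inv (F_group k n) ` std_gens k n"
  shows "g \<in> Bij {0..1} \<and> (\<exists>s>0. germ s g)"
proof -
  have *: "g \<in> Bij {0..1} \<and> (\<exists>s>0. germ s g)" if D: "is_diagram caret_types D" "represents D g" for D g
  proof -
    have "0 < 1 / real arity_prod ^ leaves (fst D)" using arity_prod_pos by simp
    then show ?thesis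
      using represents_germ[OF D] diagram_in_F[OF D] F_elements_Bij by (meson less_le_trans subsetD)
  qed
  show ?thesis
  proof (cases "g \<in> std_gens k n")
    case True
    then show ?thesis using * std_gens_diagram by blast
  next
    case False
    then obtain f where f: "f \<in> std_gens k n" "g = inv\<^bsub>F_group k n\<^esub> f" using assms by blast
    obtain D where D: "is_diagram caret_types D" "represents D f" using std_gens_diagram f(1) by blast
    obtain h where h: "represents (prod.swap D) h"
      using represents_ex1[OF is_diagram_swap[OF D(1)] zero_notin_caret_types] by blast
    then show ?thesis using *[OF is_diagram_swap[OF D(1)] h] diagram_inverse[OF D h] f(2) by simp
  qed
qed

lemma finite_std_gens: "finite (std_gens k n)"
proof -
  have "std_gens k n = (\<Union>j\<in>{2..k}. y_gen n j ` {..<n j}) \<union> (\<Union>j\<in>{1..k}. z_gen n j ` {..<n j})"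
    unfolding std_gens_def by blast
  then show ?thesis by simp
qed

text \<open>Each slope is positive, hence at least some power of 1/n_1, and finiteness allows one
  exponent for all letters. Powers of 1/n_1 are chosen so that comparison with the slope (1/n_1)^m
  becomes a comparison of exponents.\<close>

lemma std_gens_uniform_germ:
  obtains r where "\<And>g. g \<in> std_gens k n \<union> m_inv (F_group k n) ` std_gens k n \<Longrightarrow>
    \<exists>s\<ge>(1 / real (n 1)) ^ r. germ s g"
proof -
  let ?Y = "std_gens k n \<union> m_inv (F_group k n) ` std_gens k n"
  have q: "0 < 1 / real (n 1)" "1 / real (n 1) < 1" using first_arity by auto
  have "\<exists>r s. germ s g \<and> (1 / real (n 1)) ^ r \<le> s" if g: "g \<in> ?Y" for g
  proof -
    obtain s where "s > 0" "germ s g" using std_gens_and_inverses_germ[OF g] by blast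
    then show ?thesis using real_arch_pow_inv[of s "1 / real (n 1)"] q by (meson less_imp_le)
  qed
  then obtain r s where rs: "germ (s g) g" "(1 / real (n 1)) ^ r g \<le> s g" if "g \<in> ?Y" for g
    by metis
  have "(1 / real (n 1)) ^ Max (r ` ?Y) \<le> s g" if "g \<in> ?Y" for g
  proof -
    have "r g \<le> Max (r ` ?Y)" using that finite_std_gens by (intro Max_ge) auto
    then have "(1 / real (n 1)) ^ Max (r ` ?Y) \<le> (1 / real (n 1)) ^ r g"
      using q by (intro power_decreasing) auto
    then show ?thesis using rs(2)[OF that] by linarith
  qed
  then show thesis using that rs(1) by blast
qed

section \<open>The powers of the generator (z_1)_0\<close>

definition "shift = z_gen n 1 0"

lemma shift_in_std_gens: "shift \<in> std_gens k n"
  unfolding shift_def std_gens_def using first_arity(2) k_ge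
  by (intro UnI2 CollectI exI[of _ 1] exI[of _ 0]) simp

lemma string_diagram: "is_diagram caret_types (right_string (n 1) c, left_string (n 1) c)"
  unfolding is_diagram_def
  using is_tree_strings[of "n 1" caret_types c] leaves_strings[of "n 1" c] first_arity by simp

text \<open>For index 0 the right string is a single caret, and a second caret on its leftmost leaf
  turns it into a left string. For k = 1 and n_1 = 2 this is the familiar generator of Thompson's
  group F that equals x/2 on [0, 1/2].\<close>

lemma represents_shift: "represents (right_string (n 1) 2, left_string (n 1) 2) shift"
proof -
  obtain q where q: "n 1 = Suc q" using first_arity by (cases "n 1") auto
  have "attach (Suc q) 0 (right_string (Suc q) 1) = left_string (Suc q) 2"
    by (simp add: numeral_2_eq_2 replicate_append_same)
  then have T: "attach (n 1) 0 (right_string (n 1) 1) = left_string (n 1) 2" by (simp only: q)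
  have "over_right_string (n 1) (left_string (n 1) 2) = (right_string (n 1) 2, left_string (n 1) 2)"
    using leaves_strings(2)[of "n 1" 2] first_arity by (simp add: over_right_string_def)
  then have "shift = diagram_map (right_string (n 1) 2, left_string (n 1) 2)"
    using T by (simp add: shift_def z_gen_def Let_def del: right_string.simps left_string.simps)
  then show ?thesis
    using theI'[OF represents_ex1[OF string_diagram zero_notin_caret_types]] unfolding diagram_map_def by simp
qed

text \<open>The first leaf interval \<open>(0, 1/p)\<close> goes to
  \<open>(0, 1/p^2)\<close>.\<close>

lemma germ_shift: "germ (1 / real (n 1)) shift"
proof -
  let ?p = "n 1"
  have p: "?p \<ge> 1" using first_arity by simp
  have "list_all2 (affine_on shift) (leaf_intervals (right_string ?p 2) 0 1) (leaf_intervals (left_string ?p 2) 0 1)"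
    using represents_shift string_diagram represents_iff by (fastforce simp: is_diagram_def)
  moreover have "leaf_intervals (left_string ?p 2) 0 1 =
    (0, subdiv ?p 0 (subdiv ?p 0 1 1) 1) # subintervals ?p 0 (subdiv ?p 0 1 1) 1 ?p @ subintervals ?p 0 1 1 ?p"
    unfolding numeral_2_eq_2 leaf_intervals_left_string_Suc[OF p] by simp
  moreover have "subintervals ?p 0 1 0 (?p - 1) = (0, subdiv ?p 0 1 1) # subintervals ?p 0 1 1 (?p - 1)"
    unfolding subintervals_def using first_arity by (simp add: upt_conv_Cons)
  then have "leaf_intervals (right_string ?p 2) 0 1 =
    (0, subdiv ?p 0 1 1) # subintervals ?p 0 1 1 (?p - 1) @
      leaf_intervals (right_string ?p 1) (subdiv ?p 0 1 (?p - 1)) 1"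
    unfolding numeral_2_eq_2 leaf_intervals_right_string_Suc[OF p, of "Suc 0"] by simp
  ultimately have "affine_on shift (0, subdiv ?p 0 1 1) (0, subdiv ?p 0 (subdiv ?p 0 1 1) 1)"
    by (simp del: affine_on.simps)
  then have "\<forall>x\<in>{0..1 / real ?p}. shift x = 1 / real ?p * x"
    using p by (simp add: subdiv_def)
  then show ?thesis unfolding germ_def using p by (intro exI[of _ "1 / real ?p"]) auto
qed

text \<open>Written as the \<open>foldr\<close> of a word, the form used in
  \<open>word_length\<close>; so each power visibly comes with a word over the generators.\<close>

definition shift_power :: "nat \<Rightarrow> real \<Rightarrow> real" where
  "shift_power m = foldr (mult (F_group k n)) (replicate m shift) \<one>\<^bsub>F_group k n\<^esub>"

lemma represents_shift_power:
  "represents (right_string (n 1) (Suc m), left_string (n 1) (Suc m)) (shift_power m) \<and>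
    germ ((1 / real (n 1)) ^ m) (shift_power m)"
proof (induction m)
  case 0
  \<comment> \<open>With one caret the two strings are the same tree, so this diagram, though not
    minimal, represents the identity. The offset \<open>Suc m\<close> lets the formula start at m =
    0.\<close>
  have caret: "left_string (n 1) 1 = right_string (n 1) 1"
    by (simp add: replicate_append_same)
  have "list_all2 (affine_on (\<lambda>x\<in>{0..1}. x)) Is Is" if "chain 0 1 Is" for Is
  proof (rule list.rel_refl_strong)
    fix I assume "I \<in> set Is"
    then have "fst I < snd I" "0 \<le> fst I" "snd I \<le> 1" using chain_bounds[OF that] by blast+
    then show "affine_on (\<lambda>x\<in>{0..1}. x) I I" by (cases I) simp
  qed
  moreover have "chain 0 1 (leaf_intervals (right_string (n 1) 1) 0 1)"
    using string_diagram[of 1] by (intro chain_leaf_intervals[OF _ zero_notin_caret_types]) (auto simp: is_diagram_def)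
  ultimately show ?case
    using caret germ_id by (simp add: shift_power_def represents_iff del: restrict_apply)
next
  case (Suc m)
  let ?p = "n 1"
  have in_Bij: "f \<in> Bij {0..1}" if "represents (right_string ?p c, left_string ?p c) f" for c f
    using that diagram_in_F string_diagram F_elements_Bij by blast
  have "shift_power (Suc m) = shift \<otimes>\<^bsub>F_group k n\<^esub> shift_power m" by (simp add: shift_power_def)
  then have power: "shift_power (Suc m) = compose {0..1} shift (shift_power m)"
    using mult_F_group[OF in_Bij[OF represents_shift] in_Bij[OF conjunct1[OF Suc]]] by simp
  have eq: "leaves (right_string ?p c) = leaves (left_string ?p c)" for c
    using string_diagram[of c] by (simp add: is_diagram_def)
  have "list_all2 (affine_on (shift \<circ> shift_power m)) (leaf_intervals (right_string ?p (Suc (Suc m))) 0 1)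
      (leaf_intervals (left_string ?p (Suc (Suc m))) 0 1)"
    using string_pairs_comp[OF first_arity(2)] Suc represents_shift eq
    by (auto simp only: represents_iff fst_conv snd_conv)
  \<comment> \<open>\<open>compose\<close> agrees with \<open>\<circ>\<close> only on
    \<open>{0..1}\<close>; this suffices on the leaf intervals, and the restriction supplies
    extensionality.\<close>
  then have "list_all2 (affine_on (compose {0..1} shift (shift_power m)))
      (leaf_intervals (right_string ?p (Suc (Suc m))) 0 1) (leaf_intervals (left_string ?p (Suc (Suc m))) 0 1)"
  proof (rule list_all2_affine_on_cong)
    show "chain 0 1 (leaf_intervals (right_string ?p (Suc (Suc m))) 0 1)"
      using string_diagram[of "Suc (Suc m)"]
      by (intro chain_leaf_intervals[OF _ zero_notin_caret_types]) (auto simp only: is_diagram_def fst_conv zero_less_one)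
  qed (simp add: compose_def)
  then have "represents (right_string ?p (Suc (Suc m)), left_string ?p (Suc (Suc m))) (shift_power (Suc m))"
    unfolding power using eq by (simp only: represents_iff fst_conv snd_conv compose_extensional simp_thms)
  moreover have "germ ((1 / real ?p) ^ Suc m) (shift_power (Suc m))"
    unfolding power power_Suc using germ_shift Suc first_arity by (intro germ_compose) auto
  ultimately show ?case by blast
qed

section \<open>Leaf number and word length of the powers\<close>

lemma minimum_in: "S \<noteq> {} \<Longrightarrow> minimum S \<in> S"
  unfolding minimum_def by (auto intro: LeastI)

lemma minimum_le: "m \<in> S \<Longrightarrow> minimum S \<le> m"
  unfolding minimum_def by (auto intro: Least_le)

lemma leaf_number_shift_power_le: "leaf_number k n (shift_power m) \<le> Suc m * (n 1 - 1) + 1"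
proof -
  have "leaf_number k n (shift_power m) \<le> leaves (fst (right_string (n 1) (Suc m), left_string (n 1) (Suc m)))"
    unfolding leaf_number_def using string_diagram represents_shift_power by (intro minimum_le) blast
  also have "\<dots> = Suc m * (n 1 - 1) + 1" using leaves_strings(1)[of "n 1" "Suc m"] first_arity by simp
  finally show ?thesis .
qed

text \<open>A minimal diagram might be much smaller than the pair of strings, so the bound must come
  from the map itself: its slope (1/n_1)^m is at least N^(-L), whence n_1^m \<le> N^L. The weaker m
  < N^L is enough for divergence.\<close>

lemma leaf_number_shift_power_ge: "m < arity_prod ^ leaf_number k n (shift_power m)"
proof -
  let ?S = "{leaves (fst D) | D. is_diagram caret_types D \<and> represents D (shift_power m)}"
  have "minimum ?S \<in> ?S"
    using string_diagram represents_shift_power by (intro minimum_in) blast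
  then obtain D where D: "is_diagram caret_types D" "represents D (shift_power m)"
    "leaf_number k n (shift_power m) = leaves (fst D)"
    unfolding leaf_number_def by auto
  obtain s where "germ s (shift_power m)" "s \<ge> 1 / real arity_prod ^ leaves (fst D)"
    using represents_germ D by blast
  then have "1 / real arity_prod ^ leaves (fst D) \<le> (1 / real (n 1)) ^ m"
    using germ_unique represents_shift_power by blast
  then have "real (n 1) ^ m \<le> real arity_prod ^ leaves (fst D)"
    using first_arity arity_prod_pos by (simp add: power_one_over divide_simps)
  then have "n 1 ^ m \<le> arity_prod ^ leaves (fst D)"
    by (metis of_nat_le_iff of_nat_power)
  moreover have "m < n 1 ^ m" using first_arity by (simp add: power_gt_expt)
  ultimately show ?thesis using D(3) by simp
qed

lemma leaf_number_shift_power_at_top: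
  "filterlim (\<lambda>m. leaf_number k n (shift_power m)) at_top sequentially"
  unfolding filterlim_at_top eventually_sequentially
proof (intro allI exI impI)
  fix C m assume m: "arity_prod ^ C \<le> m"
  show "C \<le> leaf_number k n (shift_power m)"
  proof (rule ccontr)
    assume "\<not> C \<le> leaf_number k n (shift_power m)"
    then have "arity_prod ^ leaf_number k n (shift_power m) \<le> arity_prod ^ C"
      using arity_prod_pos by (intro power_increasing) auto
    then show False using leaf_number_shift_power_ge[of m] m by linarith
  qed
qed

lemma word_length_shift_power:
  obtains r where "\<And>m. m \<le> r * word_length (F_group k n) (std_gens k n) (shift_power m)"
proof -
  let ?Y = "std_gens k n \<union> m_inv (F_group k n) ` std_gens k n"
  let ?q = "1 / real (n 1)"
  obtain r where r: "\<And>g. g \<in> ?Y \<Longrightarrow> \<exists>s\<ge>?q ^ r. germ s g"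
    using std_gens_uniform_germ by blast
  have "m \<le> r * word_length (F_group k n) (std_gens k n) (shift_power m)" for m
  proof -
    let ?S = "{length u | u. set u \<subseteq> ?Y \<and> foldr (mult (F_group k n)) u \<one>\<^bsub>F_group k n\<^esub> = shift_power m}"
    \<comment> \<open>The defining word shows that the minimum is over a nonempty set, so the
      default length 0 does not intervene and a shortest word \<open>u\<close> exists.\<close>
    have "set (replicate m shift) \<subseteq> ?Y" using shift_in_std_gens by auto
    then have "?S \<noteq> {}" unfolding shift_power_def by blast
    then have "minimum ?S \<in> ?S" by (rule minimum_in)
    then obtain u where u: "set u \<subseteq> ?Y" "foldr (mult (F_group k n)) u \<one>\<^bsub>F_group k n\<^esub> = shift_power m"
      "word_length (F_group k n) (std_gens k n) (shift_power m) = length u"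
      unfolding word_length_def by auto
    have "g \<in> Bij {0..1} \<and> (\<exists>s\<ge>?q ^ r. germ s g)" if "g \<in> set u" for g
      using that u(1) r[of g] std_gens_and_inverses_germ[of g] by blast
    moreover have "?q > 0" using first_arity by simp
    ultimately obtain s where "germ s (shift_power m)" "?q ^ (r * length u) \<le> s"
      using foldr_germ[of u ?q r] unfolding u(2) by blast
    then have "?q ^ (r * length u) \<le> ?q ^ m"
      using germ_unique represents_shift_power by blast
    \<comment> \<open>The base is below 1, so the inequality between the powers reverses for the
      exponents.\<close>
    then have "m \<le> r * length u" using first_arity by (subst (asm) power_decreasing_iff) auto
    then show ?thesis using u(3) by simp
  qed
  then show thesis using that by blast
qed

lemma linear_lower_bound:
  "\<exists>\<epsilon>::real. \<epsilon> > 0 \<and> (\<forall>m\<ge>1. real (word_length (F_group k n) (std_gens k n) (shift_power m))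
    \<ge> \<epsilon> * real (leaf_number k n (shift_power m)))"
proof -
  obtain r where r: "\<And>m. m \<le> r * word_length (F_group k n) (std_gens k n) (shift_power m)"
    using word_length_shift_power by blast
  \<comment> \<open>For m = 1 the bound reads 1 \<le> r * |w_1|, which excludes r = 0.\<close>
  have pos: "r > 0" "n 1 > 0" using r[of 1] first_arity by (auto intro: gr0I)
  have "leaf_number k n (shift_power m) \<le> 3 * n 1 * r * word_length (F_group k n) (std_gens k n) (shift_power m)"
    if "m \<ge> 1" for m
  proof -
    have "leaf_number k n (shift_power m) \<le> Suc m * n 1 + n 1"
      using leaf_number_shift_power_le[of m] mult_le_mono2[of "n 1 - 1" "n 1" "Suc m"] first_arity
      by linarith
    \<comment> \<open>This uses m + 2 \<le> 3 m, valid from m = 1 on. At m = 0 the element is the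
      identity, of word length 0 but with one leaf.\<close>
    also have "\<dots> \<le> 3 * n 1 * m" using that by (cases m) auto
    also have "\<dots> \<le> 3 * n 1 * (r * word_length (F_group k n) (std_gens k n) (shift_power m))"
      using r by (intro mult_le_mono) auto
    finally show ?thesis by simp
  qed
  then have "real (leaf_number k n (shift_power m))
      \<le> real (3 * n 1 * r) * real (word_length (F_group k n) (std_gens k n) (shift_power m))" if "m \<ge> 1" for m
    using that by (metis of_nat_le_iff of_nat_mult)
  then show ?thesis
    using pos by (intro exI[of _ "1 / real (3 * n 1 * r)"]) (auto simp: divide_simps mult_ac)
qed

end

theorem mainTheorem12:
  fixes k :: nat and n :: "nat \<Rightarrow> nat"
  assumes "k \<ge> 1"
    and "\<forall>j\<in>{1..k}. n j \<ge> 2"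
    and "\<forall>j\<in>{1..k}. (n 1 - 1) dvd (n j - 1)"
  shows "\<exists>\<epsilon>::real. \<epsilon> > 0 \<and>
    (\<exists>w :: nat \<Rightarrow> real \<Rightarrow> real.
      (\<forall>m\<ge>1. w m \<in> carrier (F_group k n)) \<and>
      filterlim (\<lambda>m. leaf_number k n (w m)) at_top sequentially \<and>
      (\<forall>m\<ge>1. real (word_length (F_group k n) (std_gens k n) (w m))
               \<ge> \<epsilon> * real (leaf_number k n (w m))))"
proof -
  interpret tree_group k n using assms by unfold_locales auto
  have "shift_power m \<in> carrier (F_group k n)" for m
    unfolding carrier_F_group by (rule diagram_in_F[OF string_diagram conjunct1[OF represents_shift_power]])
  then show ?thesis
    using linear_lower_bound leaf_number_shift_power_at_top by blast
qed

end
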